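(* Let $X$ be a countably infinite set. Every ideal clone on $X$ is contained in a precomplete clone on $X$. Moreover, every precomplete clone on $X$ which contains an ideal clone is itself an ideal clone.
   Context: Let $\mathcal O^{(n)}$ be the set of all functions $X^n\to X$ ($n\ge 1$) and $\mathcal O=\bigcup_{n\ge1}\mathcal O^{(n)}$. A clone on $X$ is a subset of $\mathcal O$ that contains all projections and is closed under composition. A clone $\mathcal C\neq\mathcal O$ is precomplete if there is no clone strictly between $\mathcal C$ and $\mathcal O$. An ideal on $X$ means here a family $I$ of subsets of $X$ that is closed under subsets and finite unions, contains all finite subsets of $X$, contains at least one infinite set, and does not contain all subsets of $X$. For an ideal $I$, $\mathcal C_I=\bigcup_{n\ge1}\{f\in\mathcal O^{(n)}: f[A^n]\in I\text{ for all }A\in I\}$. An ideal clone is a clone of the form $\mathcal C_I$ for some ideal $I$ on $X$ (that is, for some family $I$ of subsets of $X$ that is closed under subsets and finite unions, contains all finite subsets of $X$, contains at least one infinite set, and does not contain all subsets of $X$). *)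

theory Defs
  imports "HOL-Library.FuncSet" "HOL-Library.NList" "HOL-Library.Countable_Set"
begin

declare nlistsE_length [simp del] nlistsE_set [simp del]

text \<open>The power \<open>X\<^sup>n\<close> is the set \<open>nlists n X\<close> of lists of length \<open>n\<close> over \<open>X\<close>. An operation carries
  its arity explicitly: an extensional function alone need not determine its arity (if
  \<open>undefined \<in> X\<close>, the constant operations with value \<open>undefined\<close> would be identified for all arities).\<close>

type_synonym 'a operation = "nat \<times> ('a list \<Rightarrow> 'a)"

definition operations :: "'a set \<Rightarrow> 'a operation set" where
  "operations X = (SIGMA n : {1..}. nlists n X \<rightarrow>\<^sub>E X)"

definition projection :: "'a set \<Rightarrow> nat \<Rightarrow> nat \<Rightarrow> 'a list \<Rightarrow> 'a" where
  "projection X n i = (\<lambda>xs \<in> nlists n X. xs ! i)"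

definition composition ::
    "'a set \<Rightarrow> nat \<Rightarrow> ('a list \<Rightarrow> 'a) \<Rightarrow> ('a list \<Rightarrow> 'a) list \<Rightarrow> 'a list \<Rightarrow> 'a" where
  "composition X n f gs = (\<lambda>xs \<in> nlists n X. f (map (\<lambda>g. g xs) gs))"

definition clone :: "'a set \<Rightarrow> 'a operation set \<Rightarrow> bool" where
  "clone X C \<longleftrightarrow>
     C \<subseteq> operations X \<and>
     (\<forall>n\<ge>1. \<forall>i<n. (n, projection X n i) \<in> C) \<and>
     (\<forall>k n f gs. (k, f) \<in> C \<and> length gs = k \<and> (\<forall>g \<in> set gs. (n, g) \<in> C)
        \<longrightarrow> (n, composition X n f gs) \<in> C)"

definition precomplete_clone :: "'a set \<Rightarrow> 'a operation set \<Rightarrow> bool" where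
  "precomplete_clone X C \<longleftrightarrow>
     clone X C \<and> C \<noteq> operations X \<and> \<not> (\<exists>D. clone X D \<and> C \<subset> D \<and> D \<subset> operations X)"

definition set_ideal :: "'a set \<Rightarrow> 'a set set \<Rightarrow> bool" where
  "set_ideal X I \<longleftrightarrow>
     I \<subseteq> Pow X \<and>
     (\<forall>A\<in>I. \<forall>B. B \<subseteq> A \<longrightarrow> B \<in> I) \<and>
     (\<forall>A\<in>I. \<forall>B\<in>I. A \<union> B \<in> I) \<and>
     (\<forall>A. A \<subseteq> X \<and> finite A \<longrightarrow> A \<in> I) \<and>
     (\<exists>A\<in>I. infinite A) \<and>
     I \<noteq> Pow X"

definition ideal_operations :: "'a set \<Rightarrow> 'a set set \<Rightarrow> 'a operation set" where
  "ideal_operations X I = {(n, f) \<in> operations X. \<forall>A\<in>I. f ` nlists n A \<in> I}"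

definition ideal_clone :: "'a set \<Rightarrow> 'a operation set \<Rightarrow> bool" where
  "ideal_clone X C \<longleftrightarrow> clone X C \<and> (\<exists>I. set_ideal X I \<and> C = ideal_operations X I)"

lemma clone_ideal_operations:
  assumes "set_ideal X I"
  shows "clone X (ideal_operations X I)"
proof -
  have down: "B \<in> I" if "A \<in> I" "B \<subseteq> A" for A B
    using assms that unfolding set_ideal_def by blast
  have subX: "A \<subseteq> X" if "A \<in> I" for A
    using assms that unfolding set_ideal_def by blast
  have un: "A \<union> B \<in> I" if "A \<in> I" "B \<in> I" for A B
    using assms that unfolding set_ideal_def by blast
  have emp: "{} \<in> I"
    using assms unfolding set_ideal_def by blast
  have mem: "xs \<in> nlists n A \<longleftrightarrow> length xs = n \<and> (\<forall>x\<in>set xs. x \<in> A)"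
    for xs :: "'a list" and n A
    unfolding nlists_def by blast
  have mono: "xs \<in> nlists n X" if "xs \<in> nlists n A" "A \<in> I" for xs n A
    using that(1) subX[OF that(2)] unfolding mem by blast
  have 1: "(n, projection X n i) \<in> ideal_operations X I" if "i < n" for n i
  proof -
    have "projection X n i ` nlists n A \<subseteq> A" if "A \<in> I" for A
    proof
      fix y assume "y \<in> projection X n i ` nlists n A"
      then obtain xs where xs: "xs \<in> nlists n A" "y = projection X n i xs" by blast
      then have "y = xs ! i"
        using mono[OF xs(1) that] by (simp add: projection_def)
      then show "y \<in> A"
        using xs(1) \<open>i < n\<close> unfolding mem by (metis nth_mem)
    qed
    then have "projection X n i ` nlists n A \<in> I" if "A \<in> I" for A
      using down[OF that] that by blast
    moreover have "projection X n i \<in> nlists n X \<rightarrow>\<^sub>E X"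
    proof -
      have "xs ! i \<in> X" if "xs \<in> nlists n X" for xs
        using that \<open>i < n\<close> unfolding mem by (metis nth_mem)
      then show ?thesis unfolding projection_def by (simp add: restrict_PiE_iff)
    qed
    ultimately show ?thesis
      using \<open>i < n\<close> by (simp add: ideal_operations_def operations_def)
  qed
  have 2: "(n, composition X n f gs) \<in> ideal_operations X I"
    if f: "(k, f) \<in> ideal_operations X I" and len: "length gs = k"
      and gs: "\<forall>g \<in> set gs. (n, g) \<in> ideal_operations X I" for k n f gs
  proof -
    have k: "k \<ge> 1" and fX: "f \<in> nlists k X \<rightarrow>\<^sub>E X"
      using f by (auto simp: ideal_operations_def operations_def)
    have gX: "g \<in> nlists n X \<rightarrow>\<^sub>E X" "n \<ge> 1" if "g \<in> set gs" for g
      using gs that by (auto simp: ideal_operations_def operations_def)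
    have n: "n \<ge> 1" using k len gX(2)[of "hd gs"] by (cases gs) auto
    have map: "map (\<lambda>g. g xs) gs \<in> nlists k X" if "xs \<in> nlists n X" for xs
      using PiE_mem[OF gX(1) that] len unfolding mem[of _ k] set_map length_map by blast
    have "composition X n f gs \<in> nlists n X \<rightarrow>\<^sub>E X"
      using PiE_mem[OF fX map] unfolding composition_def by (simp add: restrict_PiE_iff)
    moreover have "composition X n f gs ` nlists n A \<in> I" if A: "A \<in> I" for A
    proof -
      define B where "B = (\<Union>g\<in>set gs. g ` nlists n A)"
      have "(\<Union>g\<in>G. g ` nlists n A) \<in> I" if "finite G" "G \<subseteq> set gs" for G
        using that
      proof (induction G rule: finite_induct)
        case (insert g G)
        then have "g ` nlists n A \<in> I"
          using gs A by (auto simp: ideal_operations_def)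
        then show ?case using insert un by simp
      qed (simp add: emp)
      then have "B \<in> I" unfolding B_def by simp
      then have "f ` nlists k B \<in> I"
        using f by (auto simp: ideal_operations_def)
      moreover have "composition X n f gs ` nlists n A \<subseteq> f ` nlists k B"
      proof
        fix y assume "y \<in> composition X n f gs ` nlists n A"
        then obtain xs where xs: "xs \<in> nlists n A" "y = composition X n f gs xs" by blast
        then have "y = f (map (\<lambda>g. g xs) gs)"
          using mono[OF xs(1) A] by (simp add: composition_def)
        moreover have "map (\<lambda>g. g xs) gs \<in> nlists k B"
          using xs(1) len unfolding mem[of _ k] B_def set_map length_map by blast
        ultimately show "y \<in> f ` nlists k B" by blast
      qed
      ultimately show ?thesis using down by blast
    qed
    ultimately show ?thesis
      using n by (simp add: ideal_operations_def operations_def)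
  qed
  have "ideal_operations X I \<subseteq> operations X"
    unfolding ideal_operations_def by blast
  then show ?thesis
    unfolding clone_def using 1 2 by blast
qed

end

theory Submission
  imports Defs
begin

text \<open>Everything rests on attaching to a clone \<open>D\<close> the family \<open>J\<close> of those \<open>B \<subseteq> X\<close> such that \<open>D\<close>
  contains \<^emph>\<open>every\<close> operation whose values lie in \<open>B\<close>. If \<open>f \<in> D\<close> and \<open>B \<in> J\<close>, an operation with
  values in \<open>f[B\<^sup>k]\<close> factors through \<open>f\<close>, the inner operations having values in \<open>B\<close>; hence it is in
  \<open>D\<close>. So \<open>D\<close> preserves \<open>J\<close> (\<open>image_in_full_ranges\<close>).

  Let \<open>D\<close> contain an ideal clone \<open>\<C>\<^sub>I\<close>. Then \<open>I \<subseteq> J\<close>, and \<open>J\<close> is closed under unions, because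
  \<open>\<C>\<^sub>I\<close> contains a ternary case distinction. The whole set \<open>X\<close> is in \<open>J\<close> only if \<open>D\<close> is the clone of
  all operations. So, for \<open>D\<close> proper, \<open>J\<close> is an ideal and \<open>D\<close> is contained in the ideal clone of \<open>J\<close>.
  When \<open>X\<close> is countable an ideal clone is proper, since some unary operation maps an infinite set
  of the ideal onto \<open>X\<close>; a precomplete \<open>D\<close> is therefore equal to the ideal clone of \<open>J\<close>.

  That same unary operation, added to \<open>\<C>\<^sub>I\<close>, puts \<open>X\<close> into \<open>J\<close> and so generates all operations. A clone
  over which the clone of all operations is generated by one element is contained in a precomplete
  one, by Zorn's lemma applied to the clones that omit this element.\<close>

lemma nlists_iff: "xs \<in> nlists n A \<longleftrightarrow> length xs = n \<and> set xs \<subseteq> A"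
  by (auto simp: nlists_def)

lemma operation_value_in:
  assumes "(n, f) \<in> operations X" and "xs \<in> nlists n X"
  shows "f xs \<in> X"
  using assms by (auto simp: operations_def)

lemma operation_arity_pos: "(n, f) \<in> operations X \<Longrightarrow> n \<ge> 1"
  by (simp add: operations_def)

lemma restrict_in_operations:
  assumes "n \<ge> 1" and "\<And>xs. xs \<in> nlists n X \<Longrightarrow> f xs \<in> X"
  shows "(n, restrict f (nlists n X)) \<in> operations X"
  using assms by (auto simp: operations_def)

lemma operation_eqI:
  assumes "(n, f) \<in> operations X" and "(n, g) \<in> operations X"
    and "\<And>xs. xs \<in> nlists n X \<Longrightarrow> f xs = g xs"
  shows "f = g"
  using assms by (intro PiE_ext[of f "nlists n X" "\<lambda>_. X" g]) (auto simp: operations_def)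

lemma clone_subset: "clone X C \<Longrightarrow> C \<subseteq> operations X"
  by (simp add: clone_def)

lemma clone_composition:
  assumes "clone X C" and "(length gs, f) \<in> C" and "\<And>g. g \<in> set gs \<Longrightarrow> (n, g) \<in> C"
  shows "(n, composition X n f gs) \<in> C"
  using assms unfolding clone_def by simp

lemma cloneI:
  assumes "C \<subseteq> operations X"
    and "\<And>n i. i < n \<Longrightarrow> (n, projection X n i) \<in> C"
    and "\<And>n f gs. (length gs, f) \<in> C \<Longrightarrow> (\<And>g. g \<in> set gs \<Longrightarrow> (n, g) \<in> C) \<Longrightarrow>
      (n, composition X n f gs) \<in> C"
  shows "clone X C"
  using assms by (simp add: clone_def)

lemma clone_operations: "clone X (operations X)"
proof (rule cloneI)
  show "(n, projection X n i) \<in> operations X" if "i < n" for n i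
    unfolding projection_def
  proof (rule restrict_in_operations)
    show "xs ! i \<in> X" if "xs \<in> nlists n X" for xs
      using that \<open>i < n\<close> nth_mem[of i xs] by (auto simp: nlists_iff)
  qed (use that in simp)
  show "(n, composition X n f gs) \<in> operations X"
    if f: "(length gs, f) \<in> operations X" and gs: "\<And>g. g \<in> set gs \<Longrightarrow> (n, g) \<in> operations X"
    for n f and gs :: "('a list \<Rightarrow> 'a) list"
    unfolding composition_def
  proof (rule restrict_in_operations)
    have "gs \<noteq> []" using operation_arity_pos[OF f] by auto
    then show "n \<ge> 1" using operation_arity_pos[OF gs[OF hd_in_set]] by simp
    fix xs assume xs: "xs \<in> nlists n X"
    have "map (\<lambda>g. g xs) gs \<in> nlists (length gs) X"
      using operation_value_in[OF gs xs] by (auto simp: nlists_iff)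
    then show "f (map (\<lambda>g. g xs) gs) \<in> X" by (rule operation_value_in[OF f])
  qed
qed simp

section \<open>Precomplete clones from Zorn's lemma\<close>

text \<open>Compositions are finitary: the outer operation and the finitely many inner operations of a
  composition all lie in one member of the chain.\<close>

lemma clone_Union_chain:
  assumes "\<CC> \<noteq> {}" and "subset.chain UNIV \<CC>" and "\<And>C. C \<in> \<CC> \<Longrightarrow> clone X C"
  shows "clone X (\<Union>\<CC>)"
proof (rule cloneI)
  show "(n, composition X n f gs) \<in> \<Union>\<CC>"
    if f: "(length gs, f) \<in> \<Union>\<CC>" and gs: "\<And>g. g \<in> set gs \<Longrightarrow> (n, g) \<in> \<Union>\<CC>" for n f gs
  proof -
    have "finite (insert (length gs, f) (Pair n ` set gs))" by simp
    moreover have "insert (length gs, f) (Pair n ` set gs) \<subseteq> \<Union>\<CC>" using f gs by auto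
    ultimately obtain C where "C \<in> \<CC>" "insert (length gs, f) (Pair n ` set gs) \<subseteq> C"
      using assms(1,2) by (rule finite_subset_Union_chain)
    then have "(n, composition X n f gs) \<in> C"
      by (intro clone_composition assms(3)) auto
    then show ?thesis using \<open>C \<in> \<CC>\<close> by blast
  qed
  show "(n, projection X n i) \<in> \<Union>\<CC>" if "i < n" for n i
  proof -
    obtain C where "C \<in> \<CC>" using assms(1) by blast
    moreover have "(n, projection X n i) \<in> C"
      using assms(3)[OF \<open>C \<in> \<CC>\<close>] that by (simp add: clone_def)
    ultimately show ?thesis by blast
  qed
  show "\<Union>\<CC> \<subseteq> operations X"
    using assms(3) clone_subset by blast
qed

text \<open>A clone that is maximal among those omitting \<open>p\<close> is precomplete, because every larger clone
  contains \<open>p\<close>.\<close>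

lemma precomplete_clone_above:
  assumes C: "clone X C" and p: "p \<in> operations X" "p \<notin> C"
    and gen: "\<And>D. clone X D \<Longrightarrow> C \<subseteq> D \<Longrightarrow> p \<in> D \<Longrightarrow> D = operations X"
  shows "\<exists>D. precomplete_clone X D \<and> C \<subseteq> D"
proof -
  define \<F> where "\<F> = {D. clone X D \<and> C \<subseteq> D \<and> p \<notin> D}"
  have "\<Union>\<CC> \<in> \<F>" if "\<CC> \<noteq> {}" "subset.chain \<F> \<CC>" for \<CC>
  proof -
    have sub: "\<CC> \<subseteq> \<F>" and "subset.chain UNIV \<CC>"
      using that(2) by (auto simp: subset_chain_def)
    then have "clone X (\<Union>\<CC>)"
      using that(1) by (intro clone_Union_chain) (auto simp: \<F>_def)
    then show ?thesis using sub that(1) by (auto simp: \<F>_def)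
  qed
  moreover have "\<F> \<noteq> {}" using C p by (auto simp: \<F>_def)
  ultimately obtain M where M: "M \<in> \<F>" and max: "\<And>D. D \<in> \<F> \<Longrightarrow> M \<subseteq> D \<Longrightarrow> D = M"
    using subset_Zorn_nonempty[of \<F>] by metis
  have "D = operations X" if "clone X D" "M \<subset> D" for D
    using that M max[of D] gen[of D] by (auto simp: \<F>_def)
  then have "precomplete_clone X M"
    using M p(1) by (auto simp: precomplete_clone_def \<F>_def)
  then show ?thesis using M by (auto simp: \<F>_def)
qed

section \<open>The sets all of whose operations belong to a clone\<close>

definition full_ranges :: "'a set \<Rightarrow> 'a operation set \<Rightarrow> 'a set set" where
  "full_ranges X D =
     {B. B \<subseteq> X \<and> (\<forall>n h. (n, h) \<in> operations X \<and> h ` nlists n X \<subseteq> B \<longrightarrow> (n, h) \<in> D)}"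

lemma full_rangesD:
  assumes "B \<in> full_ranges X D" and "(n, h) \<in> operations X"
    and "\<And>xs. xs \<in> nlists n X \<Longrightarrow> h xs \<in> B"
  shows "(n, h) \<in> D"
  using assms by (auto simp: full_ranges_def image_subset_iff)

text \<open>For each argument choose a preimage in \<open>B\<^sup>k\<close>; its coordinates are the values of the inner
  operations.\<close>

lemma factor_through_image:
  assumes f: "(k, f) \<in> operations X" and B: "B \<subseteq> X"
    and h: "(n, h) \<in> operations X" "h ` nlists n X \<subseteq> f ` nlists k B"
  obtains gs where "length gs = k" and "h = composition X n f gs"
    and "\<And>g. g \<in> set gs \<Longrightarrow> (n, g) \<in> operations X"
    and "\<And>g xs. g \<in> set gs \<Longrightarrow> xs \<in> nlists n X \<Longrightarrow> g xs \<in> B"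
proof -
  define s where "s xs = inv_into (nlists k B) f (h xs)" for xs
  have "h xs \<in> f ` nlists k B" if "xs \<in> nlists n X" for xs
    using h(2) that by blast
  then have s: "s xs \<in> nlists k B \<and> f (s xs) = h xs" if "xs \<in> nlists n X" for xs
    unfolding s_def using that by (simp add: inv_into_into f_inv_into_f)
  have s_nth: "s xs ! i \<in> B" if "xs \<in> nlists n X" "i < k" for xs i
    using s[OF that(1)] that(2) by (auto simp: nlists_iff)
  define gs where "gs = map (\<lambda>i. \<lambda>xs\<in>nlists n X. s xs ! i) [0..<k]"
  have len: "length gs = k" by (simp add: gs_def)
  have gs_B: "g xs \<in> B" if "g \<in> set gs" "xs \<in> nlists n X" for g xs
    using that s_nth by (auto simp: gs_def)
  have gs_op: "(n, g) \<in> operations X" if g: "g \<in> set gs" for g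
  proof -
    obtain i where "i < k" "g = (\<lambda>xs\<in>nlists n X. s xs ! i)"
      using g by (auto simp: gs_def)
    then show ?thesis
      using s_nth B by (auto intro!: restrict_in_operations operation_arity_pos[OF h(1)])
  qed
  have "h = composition X n f gs"
  proof (rule operation_eqI[OF h(1)])
    show "(n, composition X n f gs) \<in> operations X"
      using f len gs_op by (intro clone_composition clone_operations) auto
    fix xs assume xs: "xs \<in> nlists n X"
    have "map (\<lambda>g. g xs) gs = map (\<lambda>i. s xs ! i) [0..<k]"
      using xs by (simp add: gs_def)
    also have "\<dots> = s xs"
      using s[OF xs] by (auto simp: nlists_iff map_nth)
    finally show "h xs = composition X n f gs xs"
      using s[OF xs] xs by (simp add: composition_def)
  qed
  then show thesis using that len gs_op gs_B by blast
qed

lemma image_in_full_ranges: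
  assumes D: "clone X D" and f: "(k, f) \<in> D" and B: "B \<in> full_ranges X D"
  shows "f ` nlists k B \<in> full_ranges X D"
proof -
  have f_op: "(k, f) \<in> operations X" using clone_subset[OF D] f by blast
  have BX: "B \<subseteq> X" using B by (simp add: full_ranges_def)
  have "(n, h) \<in> D" if h: "(n, h) \<in> operations X" "h ` nlists n X \<subseteq> f ` nlists k B" for n h
  proof -
    obtain gs where gs: "length gs = k" "h = composition X n f gs"
      "\<And>g. g \<in> set gs \<Longrightarrow> (n, g) \<in> operations X"
      "\<And>g xs. g \<in> set gs \<Longrightarrow> xs \<in> nlists n X \<Longrightarrow> g xs \<in> B"
      using factor_through_image[OF f_op BX h] by blast
    show ?thesis
      unfolding gs(2) using f gs(1) full_rangesD[OF B gs(3,4)]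
      by (intro clone_composition[OF D]) auto
  qed
  moreover have "f ` nlists k B \<subseteq> X"
    using operation_value_in[OF f_op] BX by (auto simp: nlists_iff)
  ultimately show ?thesis by (simp add: full_ranges_def)
qed

lemma subset_ideal_operations_full_ranges:
  assumes "clone X D"
  shows "D \<subseteq> ideal_operations X (full_ranges X D)"
proof (rule subrelI)
  fix k f assume f: "(k, f) \<in> D"
  then have "(k, f) \<in> operations X" using clone_subset[OF assms] by blast
  then show "(k, f) \<in> ideal_operations X (full_ranges X D)"
    using image_in_full_ranges[OF assms f] by (simp add: ideal_operations_def)
qed

lemma whole_in_full_ranges_iff:
  assumes "clone X D"
  shows "X \<in> full_ranges X D \<longleftrightarrow> D = operations X"
proof
  assume X: "X \<in> full_ranges X D"
  have "operations X \<subseteq> D"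
  proof (rule subrelI)
    fix n h assume h: "(n, h) \<in> operations X"
    show "(n, h) \<in> D"
      using full_rangesD[OF X h operation_value_in[OF h]] .
  qed
  then show "D = operations X" using clone_subset[OF assms] by blast
qed (simp add: full_ranges_def)

section \<open>Clones that contain an ideal clone\<close>

lemma ideal_mem_full_ranges:
  assumes I: "set_ideal X I" and sub: "ideal_operations X I \<subseteq> D"
  shows "I \<subseteq> full_ranges X D"
proof
  fix A assume A: "A \<in> I"
  have down: "\<And>A B. A \<in> I \<Longrightarrow> B \<subseteq> A \<Longrightarrow> B \<in> I" and IX: "I \<subseteq> Pow X"
    using I by (simp_all add: set_ideal_def)
  have "(n, h) \<in> D" if h: "(n, h) \<in> operations X" "h ` nlists n X \<subseteq> A" for n h
  proof -
    have "h ` nlists n B \<subseteq> A" if "B \<in> I" for B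
      using that h(2) IX by (fastforce simp: nlists_iff)
    then have "(n, h) \<in> ideal_operations X I"
      using h(1) down[OF A] by (simp add: ideal_operations_def)
    then show ?thesis using sub by blast
  qed
  then show "A \<in> full_ranges X D"
    using A IX by (auto simp: full_ranges_def)
qed

definition case_distinction :: "'a set \<Rightarrow> 'a \<Rightarrow> 'a list \<Rightarrow> 'a" where
  "case_distinction X a = (\<lambda>xs\<in>nlists 3 X. if xs ! 0 = a then xs ! 1 else xs ! 2)"

text \<open>The case distinction always returns one of its arguments, so it preserves every subset.\<close>

lemma case_distinction_in_ideal_operations:
  assumes "set_ideal X I"
  shows "(3, case_distinction X a) \<in> ideal_operations X I"
proof -
  have down: "\<And>A B. A \<in> I \<Longrightarrow> B \<subseteq> A \<Longrightarrow> B \<in> I" and IX: "I \<subseteq> Pow X"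
    using assms by (simp_all add: set_ideal_def)
  have pick: "(if xs ! 0 = a then xs ! 1 else xs ! 2) \<in> A" if "xs \<in> nlists 3 A" for xs A
    using that nth_mem[of 1 xs] nth_mem[of 2 xs] by (auto simp: nlists_iff)
  have "case_distinction X a ` nlists 3 A \<subseteq> A" if "A \<in> I" for A
  proof -
    have "nlists 3 A \<subseteq> nlists 3 X"
      using that IX by (force simp: nlists_iff)
    then have "case_distinction X a xs = (if xs ! 0 = a then xs ! 1 else xs ! 2)"
      if "xs \<in> nlists 3 A" for xs
      using that by (auto simp: case_distinction_def)
    then show ?thesis using pick by fastforce
  qed
  moreover have "(3, case_distinction X a) \<in> operations X"
    unfolding case_distinction_def using pick by (intro restrict_in_operations) auto
  ultimately show ?thesis
    using down by (auto simp: ideal_operations_def)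
qed

text \<open>An operation with values in \<open>B \<union> C\<close> is assembled by the case distinction from an operation
  with values in \<open>B\<close>, one with values in \<open>C\<close>, and a two-valued operation that records which of
  the two to use. Two-valued operations are in \<open>D\<close> because finite sets are in the ideal.\<close>

lemma full_ranges_Un:
  assumes inf: "infinite X" and I: "set_ideal X I" and D: "clone X D"
    and sub: "ideal_operations X I \<subseteq> D"
    and B: "B \<in> full_ranges X D" and C: "C \<in> full_ranges X D"
  shows "B \<union> C \<in> full_ranges X D"
proof (cases "B = {} \<or> C = {}")
  case True
  then show ?thesis using B C by auto
next
  case False
  then obtain b c where b: "b \<in> B" and c: "c \<in> C" by blast
  have BX: "B \<subseteq> X" and CX: "C \<subseteq> X"
    using B C by (simp_all add: full_ranges_def)
  obtain b' where b': "b' \<in> X" "b' \<noteq> b"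
    using infinite_remove[OF inf, of b] infinite_imp_nonempty by blast
  have "\<And>A. A \<subseteq> X \<and> finite A \<Longrightarrow> A \<in> I"
    using I by (simp add: set_ideal_def)
  then have "{b, b'} \<in> I"
    using b b' BX by auto
  then have two: "{b, b'} \<in> full_ranges X D"
    using ideal_mem_full_ranges[OF I sub] by blast
  have "(n, h) \<in> D" if h: "(n, h) \<in> operations X" "h ` nlists n X \<subseteq> B \<union> C" for n h
  proof -
    define u where "u = (\<lambda>xs\<in>nlists n X. if h xs \<in> B then b else b')"
    define hB where "hB = (\<lambda>xs\<in>nlists n X. if h xs \<in> B then h xs else b)"
    define hC where "hC = (\<lambda>xs\<in>nlists n X. if h xs \<in> C then h xs else c)"
    note n = operation_arity_pos[OF h(1)] and hX = operation_value_in[OF h(1)]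
    have u: "(n, u) \<in> D"
      unfolding u_def using n b b'(1) BX
      by (intro full_rangesD[OF two] restrict_in_operations) auto
    have hB: "(n, hB) \<in> D"
      unfolding hB_def using n b BX hX
      by (intro full_rangesD[OF B] restrict_in_operations) auto
    have hC: "(n, hC) \<in> D"
      unfolding hC_def using n c CX hX
      by (intro full_rangesD[OF C] restrict_in_operations) auto
    have mem: "(n, composition X n (case_distinction X b) [u, hB, hC]) \<in> D"
    proof (rule clone_composition[OF D])
      show "(length [u, hB, hC], case_distinction X b) \<in> D"
        using sub case_distinction_in_ideal_operations[OF I, of b]
        by (auto simp: numeral_3_eq_3)
    qed (use u hB hC in auto)
    have "h = composition X n (case_distinction X b) [u, hB, hC]"
    proof (rule operation_eqI[OF h(1)])
      show "(n, composition X n (case_distinction X b) [u, hB, hC]) \<in> operations X"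
        using mem clone_subset[OF D] by blast
      fix xs assume xs: "xs \<in> nlists n X"
      have "h xs \<in> B \<or> h xs \<in> C" using h(2) xs by blast
      moreover have "u xs \<in> X" "hB xs \<in> X" "hC xs \<in> X"
        using u hB hC clone_subset[OF D] operation_value_in[OF _ xs] by blast+
      then have "[u xs, hB xs, hC xs] \<in> nlists 3 X" by (simp add: nlists_iff)
      ultimately show "h xs = composition X n (case_distinction X b) [u, hB, hC] xs"
        using xs b'(2) by (auto simp: composition_def case_distinction_def u_def hB_def hC_def)
    qed
    then show ?thesis using mem by simp
  qed
  then show ?thesis using BX CX by (auto simp: full_ranges_def)
qed

lemma set_ideal_full_ranges:
  assumes inf: "infinite X" and I: "set_ideal X I" and D: "clone X D"
    and sub: "ideal_operations X I \<subseteq> D" and proper: "D \<noteq> operations X"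
  shows "set_ideal X (full_ranges X D)"
proof -
  have IJ: "I \<subseteq> full_ranges X D"
    by (rule ideal_mem_full_ranges[OF I sub])
  have fin: "\<forall>A. A \<subseteq> X \<and> finite A \<longrightarrow> A \<in> I" and infm: "\<exists>A\<in>I. infinite A"
    using I by (simp_all add: set_ideal_def)
  have "full_ranges X D \<subseteq> Pow X" and "\<forall>A\<in>full_ranges X D. \<forall>B. B \<subseteq> A \<longrightarrow> B \<in> full_ranges X D"
    by (auto simp: full_ranges_def)
  moreover have "full_ranges X D \<noteq> Pow X"
    using whole_in_full_ranges_iff[OF D] proper by blast
  ultimately show ?thesis
    unfolding set_ideal_def
    using IJ fin infm full_ranges_Un[OF inf I D sub] by blast
qed

section \<open>Countable base sets\<close>

text \<open>This is where countability enters: an infinite member of the ideal is equinumerous to \<open>X\<close>.\<close>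

lemma unary_operation_ideal_onto:
  assumes "countable X" and "set_ideal X I"
  obtains A f where "A \<in> I" and "(1, f) \<in> operations X" and "f ` nlists 1 A = X"
proof -
  have "I \<subseteq> Pow X" and "\<exists>A\<in>I. infinite A"
    using assms(2) by (simp_all add: set_ideal_def)
  then obtain A where A: "A \<in> I" "infinite A" and AX: "A \<subseteq> X"
    by blast
  have "countable A" and "infinite X"
    using countable_subset[OF AX assms(1)] infinite_super[OF AX A(2)] by simp_all
  define e where "e = from_nat_into X \<circ> to_nat_on A"
  have e: "bij_betw e A X"
    unfolding e_def
    using to_nat_on_infinite[OF \<open>countable A\<close> A(2)]
      bij_betw_from_nat_into[OF assms(1) \<open>infinite X\<close>]
    by (rule bij_betw_trans)
  define f where "f = (\<lambda>xs\<in>nlists 1 X. if hd xs \<in> A then e (hd xs) else hd xs)"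
  have single: "nlists 1 B = (\<lambda>x. [x]) ` B" for B :: "'a set"
    by (auto simp: nlists_iff length_Suc_conv)
  have "(1, f) \<in> operations X"
    unfolding f_def using bij_betwE[OF e]
    by (intro restrict_in_operations) (auto simp: single simp del: One_nat_def)
  moreover have "f ` nlists 1 A = e ` A"
    unfolding single image_image
  proof (rule image_cong[OF refl])
    fix x assume "x \<in> A"
    then have "[x] \<in> nlists 1 X" using AX by (auto simp: nlists_iff)
    then show "f [x] = e x" using \<open>x \<in> A\<close> by (simp add: f_def)
  qed
  ultimately show thesis
    using that[OF A(1), of f] bij_betw_imp_surj_on[OF e] by simp
qed

lemma ideal_operations_proper:
  assumes "countable X" and I: "set_ideal X I"
  shows "ideal_operations X I \<noteq> operations X"
proof -
  obtain A f where A: "A \<in> I" and f: "(1, f) \<in> operations X" "f ` nlists 1 A = X"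
    using unary_operation_ideal_onto[OF assms] by blast
  have "I \<subseteq> Pow X" and "\<forall>A\<in>I. \<forall>B. B \<subseteq> A \<longrightarrow> B \<in> I" and "I \<noteq> Pow X"
    using I by (simp_all add: set_ideal_def)
  then have "X \<notin> I" by blast
  then show ?thesis using A f by (auto simp: ideal_operations_def)
qed

lemma ideal_operations_below_precomplete:
  assumes "countable X" and I: "set_ideal X I"
  shows "\<exists>D. precomplete_clone X D \<and> ideal_operations X I \<subseteq> D"
proof -
  obtain A f where A: "A \<in> I" and f: "(1, f) \<in> operations X" "f ` nlists 1 A = X"
    using unary_operation_ideal_onto[OF assms] by blast
  have gen: "D = operations X"
    if D: "clone X D" "ideal_operations X I \<subseteq> D" "(1, f) \<in> D" for D
  proof -
    have "A \<in> full_ranges X D"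
      using ideal_mem_full_ranges[OF I D(2)] A by blast
    then have "X \<in> full_ranges X D"
      using image_in_full_ranges[OF D(1,3)] f(2) by metis
    then show ?thesis using whole_in_full_ranges_iff[OF D(1)] by simp
  qed
  have "(1, f) \<notin> ideal_operations X I"
    using gen[OF clone_ideal_operations[OF I]] ideal_operations_proper[OF assms] by blast
  then show ?thesis
    using precomplete_clone_above[OF clone_ideal_operations[OF I] f(1)] gen by blast
qed

lemma precomplete_above_ideal_operations:
  assumes "countable X" and "infinite X" and I: "set_ideal X I"
    and D: "precomplete_clone X D" and sub: "ideal_operations X I \<subseteq> D"
  shows "ideal_clone X D"
proof -
  have cl: "clone X D" and proper: "D \<noteq> operations X"
    and max: "\<And>E. clone X E \<Longrightarrow> D \<subset> E \<Longrightarrow> \<not> E \<subset> operations X"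
    using D by (auto simp: precomplete_clone_def)
  define J where "J = full_ranges X D"
  have J: "set_ideal X J"
    unfolding J_def using set_ideal_full_ranges[OF assms(2) I cl sub proper] .
  have "ideal_operations X J \<subset> operations X"
    using ideal_operations_proper[OF assms(1) J]
      clone_subset[OF clone_ideal_operations[OF J]] by blast
  moreover have "D \<subseteq> ideal_operations X J"
    unfolding J_def by (rule subset_ideal_operations_full_ranges[OF cl])
  ultimately have "D = ideal_operations X J"
    using max clone_ideal_operations[OF J] by blast
  then show ?thesis using cl J by (auto simp: ideal_clone_def)
qed

theorem theorem14:
  fixes X :: "'a set"
  assumes "countable X" and "infinite X"
  shows "(\<forall>C. ideal_clone X C \<longrightarrow> (\<exists>D. precomplete_clone X D \<and> C \<subseteq> D)) \<and>
         (\<forall>D. precomplete_clone X D \<and> (\<exists>C. ideal_clone X C \<and> C \<subseteq> D) \<longrightarrow> ideal_clone X D)"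
proof (intro conjI allI impI)
  fix C assume "ideal_clone X C"
  then show "\<exists>D. precomplete_clone X D \<and> C \<subseteq> D"
    using ideal_operations_below_precomplete[OF assms(1)] by (auto simp: ideal_clone_def)
next
  fix D assume D: "precomplete_clone X D \<and> (\<exists>C. ideal_clone X C \<and> C \<subseteq> D)"
  then obtain I where "set_ideal X I" "ideal_operations X I \<subseteq> D"
    by (auto simp: ideal_clone_def)
  then show "ideal_clone X D"
    using precomplete_above_ideal_operations[OF assms] D by simp
qed

end
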